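(* For every positive integer $n$, we have $\mu(Q_n) > \frac{14}{75}\cdot 2^n$.
   Context: For a positive integer $n$, write $[n]=\{1,\dots,n\}$. The $n$-dimensional hypercube $Q_n$ is the graph on the vertex set $2^{[n]}$ (all subsets of $[n]$), where $A,B\in 2^{[n]}$ are adjacent if and only if $|A\Delta B|=1$, with $A\Delta B=(A\setminus B)\cup(B\setminus A)$. Let $G$ be a simple graph and $M\subseteq V(G)$. Two vertices $u,v\in V(G)$ are $M$-visible if there exists a shortest $u,v$-path in $G$ that contains no vertices from $M\setminus\{u,v\}$. The set $M$ is a mutual-visibility set if any two vertices $u,v\in M$ are $M$-visible. The mutual-visibility number $\mu(G)$ is the largest size of a mutual-visibility set in $G$. *)

theory Defs
  imports Complex_Main "Graph_Theory.Vertex_Walk" "Graph_Theory.Pair_Digraph"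
begin

text \<open>A simple graph is a symmetric, loop-free digraph without parallel arcs (locale
  \<^locale>\<open>graph\<close>, which also requires finiteness); each edge is a pair of opposite arcs.
  Since there are no parallel arcs, a path is given by its list of vertices.\<close>

definition hypercube :: "nat \<Rightarrow> nat set pair_pre_digraph" where
  "hypercube n =
     \<lparr> pverts = Pow {1..n},
       parcs = {(A, B). A \<in> Pow {1..n} \<and> B \<in> Pow {1..n} \<and> card (sym_diff A B) = 1} \<rparr>"

definition shortest_path :: "('a, 'b) pre_digraph \<Rightarrow> 'a \<Rightarrow> 'a vwalk \<Rightarrow> 'a \<Rightarrow> bool" where
  "shortest_path G u p v \<longleftrightarrow>
     vpath p G \<and> hd p = u \<and> last p = v \<and>
     (\<forall>q. vpath q G \<and> hd q = u \<and> last q = v \<longrightarrow> vwalk_length p \<le> vwalk_length q)"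

definition visible :: "('a, 'b) pre_digraph \<Rightarrow> 'a set \<Rightarrow> 'a \<Rightarrow> 'a \<Rightarrow> bool" where
  "visible G M u v \<longleftrightarrow> (\<exists>p. shortest_path G u p v \<and> set p \<inter> (M - {u, v}) = {})"

definition mutual_visibility_set :: "('a, 'b) pre_digraph \<Rightarrow> 'a set \<Rightarrow> bool" where
  "mutual_visibility_set G M \<longleftrightarrow> M \<subseteq> verts G \<and> (\<forall>u\<in>M. \<forall>v\<in>M. visible G M u v)"

text \<open>Only meaningful for finite \<open>G\<close>: \<open>Max\<close> is unspecified on infinite sets.\<close>

definition mutual_visibility_number :: "('a, 'b) pre_digraph \<Rightarrow> nat" where
  "mutual_visibility_number G = Max {card M |M. mutual_visibility_set G M}"

lemma pair_graph_hypercube: "pair_graph (hypercube n)"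
proof
  show "finite (parcs (hypercube n))"
    by (rule finite_subset[of _ "Pow {1..n} \<times> Pow {1..n}"]) (auto simp: hypercube_def)
  show "symmetric (with_proj (hypercube n))"
    by (auto simp: hypercube_def symmetric_def sym_def Un_commute)
qed (auto simp: hypercube_def)

lemma mutual_visibility_number_witness:
  assumes "finite (verts G)"
  shows "\<exists>M. mutual_visibility_set G M \<and> card M = mutual_visibility_number G"
    and "mutual_visibility_set G M \<Longrightarrow> card M \<le> mutual_visibility_number G"
proof -
  let ?S = "{card M |M. mutual_visibility_set G M}"
  have "finite ?S"
    by (rule finite_subset[of _ "card ` Pow (verts G)"])
      (use assms in \<open>auto simp: mutual_visibility_set_def\<close>)
  moreover have "card {} \<in> ?S"
    by (auto simp: mutual_visibility_set_def intro!: exI[of _ "{}"])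
  ultimately have "Max ?S \<in> ?S" and ge: "\<And>k. k \<in> ?S \<Longrightarrow> k \<le> Max ?S"
    using Max_in[of ?S] Max_ge[of ?S] by blast+
  from \<open>Max ?S \<in> ?S\<close> obtain M' where "mutual_visibility_set G M'" "card M' = Max ?S"
    by (elim CollectE exE conjE) (metis)
  then show "\<exists>M. mutual_visibility_set G M \<and> card M = mutual_visibility_number G"
    unfolding mutual_visibility_number_def by blast
  show "mutual_visibility_set G M \<Longrightarrow> card M \<le> mutual_visibility_number G"
    unfolding mutual_visibility_number_def by (rule ge) blast
qed

end

theory Submission
  imports Defs "HOL-Library.FuncSet" "HOL-Library.Numeral_Type"
begin

text \<open>Take \<open>M\<close> in the layers of size \<open>i\<close> modulo 3. Between two such layers there are two free ones, so a
  geodesic can move sideways there, and it remains to cross the layers that meet \<open>M\<close>. This is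
  possible if layer \<open>r\<close> of \<open>M\<close> contains no daisy: for \<open>card C = r - 2\<close> and five further elements, some
  pair \<open>x, y\<close> of them has \<open>C \<union> {x, y} \<notin> M\<close>. Following Ellis, Ion and Leader, a dense daisy-free
  layer comes from a random assignment of vectors of \<open>F\<^sub>3\<^sup>r\<close> to the elements of the ground set, taking
  those sets whose vectors form a basis: modulo the span of \<open>C\<close>, a daisy would give five points on
  the projective line over \<open>F\<^sub>3\<close>, which has only four. A set survives with probability
  \<open>\<Prod>k=1..r. (1 - 1 / 3 ^ k) > 14 / 25\<close>, and for the best \<open>i\<close> the layers used contain at least a third
  of the cube.\<close>

section \<open>Geodesics of the hypercube\<close>

lemma pverts_hypercube [simp]: "pverts (hypercube n) = Pow {1..n}"
  by (simp add: hypercube_def)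

lemma arcs_ends_hypercube:
  "(A, B) \<in> arcs_ends (with_proj (hypercube n)) \<longleftrightarrow>
     A \<subseteq> {1..n} \<and> B \<subseteq> {1..n} \<and> card (sym_diff A B) = 1"
  by (auto simp: hypercube_def)

lemma symmetric_hypercube: "symmetric (with_proj (hypercube n))"
  by (simp only: symmetric_def sym_def arcs_ends_hypercube) (simp add: Un_commute)

lemma card_sym_diff_triangle:
  assumes "finite A" "finite B" "finite C"
  shows "card (sym_diff A C) \<le> card (sym_diff A B) + card (sym_diff B C)"
proof -
  have "card (sym_diff A C) \<le> card (sym_diff A B \<union> sym_diff B C)"
    by (rule card_mono) (use assms in auto)
  also have "\<dots> \<le> card (sym_diff A B) + card (sym_diff B C)"
    by (rule card_Un_le)
  finally show ?thesis .
qed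

text \<open>One arc changes the symmetric difference with a fixed set by at most one element. This
  lower bound certifies the walks obtained from \<open>geodesic\<close> as shortest.\<close>

lemma vwalk_hypercube_length:
  assumes "vwalk p (with_proj (hypercube n))"
  shows "card (sym_diff (hd p) (last p)) < length p"
  using assms
proof (induction p rule: vwalk_induct)
  case (Base u)
  then show ?case by simp
next
  case (Cons u v p)
  then have uv: "u \<subseteq> {1..n}" "v \<subseteq> {1..n}" "card (sym_diff u v) = 1"
    unfolding arcs_ends_hypercube by auto
  then have fin: "finite u" "finite v"
    by (auto intro: finite_subset)
  have "card (sym_diff u (last (v # p))) < Suc (length (v # p))"
  proof (cases "finite (last (v # p))")
    case True
    then show ?thesis
      using card_sym_diff_triangle[OF fin True] uv Cons by simp
  next
    \<comment> \<open>Finiteness of the last vertex is not tracked; an infinite symmetric difference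
      has \<open>card\<close> 0, so the bound holds.\<close>
    case False
    with fin(1) show ?thesis by auto
  qed
  then show ?case by simp
qed

text \<open>Reachability by a geodesic, flipping one element of the symmetric difference at a time,
  whose vertices strictly between the endpoints are not in \<open>M\<close>.\<close>

inductive geodesic :: "'a set set \<Rightarrow> 'a set \<Rightarrow> 'a set \<Rightarrow> bool" for M B where
  stop: "geodesic M B B"
| add: "geodesic M B A" if "x \<in> B - A" "insert x A \<notin> M \<or> insert x A = B" "geodesic M B (insert x A)"
| del: "geodesic M B A" if "x \<in> A - B" "A - {x} \<notin> M \<or> A - {x} = B" "geodesic M B (A - {x})"

lemma geodesic_obtains_vwalk:
  assumes "geodesic M B A" "A \<subseteq> {1..n}" "B \<subseteq> {1..n}"
  obtains p where "vwalk p (with_proj (hypercube n))" "hd p = A" "last p = B" "distinct p"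
    "length p = Suc (card (sym_diff A B))" "set p \<inter> M \<subseteq> {A, B}"
proof -
  \<comment> \<open>The last conjunct, that no vertex is farther from \<open>B\<close> than the
    first one, strengthens the induction: as \<open>A\<close> is farther from \<open>B\<close> than
    \<open>A'\<close>, it cannot occur on \<open>p\<close>, so \<open>A # p\<close> stays
    distinct.\<close>
  have step: "\<exists>p. vwalk p (with_proj (hypercube n)) \<and> hd p = A \<and> last p = B \<and> distinct p \<and>
      length p = Suc (card (sym_diff A B)) \<and> set p \<inter> M \<subseteq> {A, B} \<and>
      (\<forall>C\<in>set p. card (sym_diff C B) \<le> card (sym_diff A B))"
    if A: "A \<subseteq> {1..n}" "A' \<subseteq> {1..n}" "A' \<notin> M \<or> A' = B"
      and adj: "card (sym_diff A A') = 1" "Suc (card (sym_diff A' B)) = card (sym_diff A B)"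
      and p: "vwalk p (with_proj (hypercube n)) \<and> hd p = A' \<and> last p = B \<and> distinct p \<and>
        length p = Suc (card (sym_diff A' B)) \<and> set p \<inter> M \<subseteq> {A', B} \<and>
        (\<forall>C\<in>set p. card (sym_diff C B) \<le> card (sym_diff A' B))"
    for A A' p
  proof (intro exI[of _ "A # p"] conjI)
    have ne: "p \<noteq> []" using p by (auto simp: vwalk_def)
    show "vwalk (A # p) (with_proj (hypercube n))"
      using A adj p unfolding arcs_ends_hypercube[symmetric]
      by (intro vwalk_consI) (auto simp only: arcs_ends_hypercube with_proj_simps(1) pverts_hypercube Pow_iff)
    have "A \<notin> set p" using p adj by force
    then show "distinct (A # p)" using p by simp
    show "length (A # p) = Suc (card (sym_diff A B))" using p adj by simp
    show "set (A # p) \<inter> M \<subseteq> {A, B}" using p A by auto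
    show "\<forall>C\<in>set (A # p). card (sym_diff C B) \<le> card (sym_diff A B)"
      using p adj by auto
    show "hd (A # p) = A" "last (A # p) = B" using p ne by auto
  qed
  have "\<exists>p. vwalk p (with_proj (hypercube n)) \<and> hd p = A \<and> last p = B \<and> distinct p \<and>
      length p = Suc (card (sym_diff A B)) \<and> set p \<inter> M \<subseteq> {A, B} \<and>
      (\<forall>C\<in>set p. card (sym_diff C B) \<le> card (sym_diff A B))"
    using assms
  proof (induction)
    case stop
    then show ?case by (intro exI[of _ "[B]"]) auto
  next
    case (add x A)
    have A': "insert x A \<subseteq> {1..n}" using add by auto
    have fin: "finite A" "finite B" using add by (auto intro: finite_subset)
    have "sym_diff A (insert x A) = {x}" "sym_diff A B = insert x (sym_diff (insert x A) B)"
      "x \<notin> sym_diff (insert x A) B"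
      using add by auto
    then have d: "card (sym_diff A (insert x A)) = 1"
      "Suc (card (sym_diff (insert x A) B)) = card (sym_diff A B)"
      using fin by simp_all
    show ?case using add.IH[OF A' \<open>B \<subseteq> _\<close>] step[OF \<open>A \<subseteq> _\<close> A' _ d] add.hyps by metis
  next
    case (del x A)
    have A': "A - {x} \<subseteq> {1..n}" using del by auto
    have fin: "finite A" "finite B" using del by (auto intro: finite_subset)
    have "sym_diff A (A - {x}) = {x}" "sym_diff A B = insert x (sym_diff (A - {x}) B)"
      "x \<notin> sym_diff (A - {x}) B"
      using del by auto
    then have d: "card (sym_diff A (A - {x})) = 1"
      "Suc (card (sym_diff (A - {x}) B)) = card (sym_diff A B)"
      using fin by simp_all
    show ?case using del.IH[OF A' \<open>B \<subseteq> _\<close>] step[OF \<open>A \<subseteq> _\<close> A' _ d] del.hyps by metis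
  qed
  then show ?thesis using that by blast
qed

lemma visible_if_geodesic:
  assumes "geodesic M B A" "A \<subseteq> {1..n}" "B \<subseteq> {1..n}"
  shows "visible (with_proj (hypercube n)) M A B"
proof -
  obtain p where p: "vwalk p (with_proj (hypercube n))" "hd p = A" "last p = B" "distinct p"
    "length p = Suc (card (sym_diff A B))" "set p \<inter> M \<subseteq> {A, B}"
    using geodesic_obtains_vwalk[OF assms] .
  have "vwalk_length p \<le> vwalk_length q"
    if "vpath q (with_proj (hypercube n))" "hd q = A" "last q = B" for q
    using vwalk_hypercube_length[of q n] that p(5) by (auto simp: vpath_def)
  then show ?thesis
    using p unfolding visible_def shortest_path_def by (intro exI[of _ p]) auto
qed

text \<open>Reverse the path. Geodesics are constructed below only towards a set of at least the
  same size.\<close>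

lemma visible_commute:
  assumes "symmetric G" "visible G M u v"
  shows "visible G M v u"
proof -
  obtain p where p: "shortest_path G u p v" "set p \<inter> (M - {u, v}) = {}"
    using assms(2) unfolding visible_def by blast
  have rev: "vpath (rev q) G" if "vpath q G" for q
    using that vwalk_rev_ex[OF assms(1)] unfolding vpath_def by simp
  have hd_last: "hd (rev q) = last q \<and> last (rev q) = hd q" if "vpath q G" for q
    using that by (auto simp: vpath_def vwalk_def hd_rev last_rev)
  have "shortest_path G v (rev p) u"
    using p(1) rev hd_last unfolding shortest_path_def
    by (metis length_rev vwalk_length_simp)
  with p(2) show ?thesis
    unfolding visible_def by (intro exI[of _ "rev p"]) (simp add: insert_commute)
qed

section \<open>Visibility in daisy-free families\<close>

lemma Suc_mod_3_neq: "Suc k mod 3 \<noteq> k mod 3" "Suc (Suc k) mod 3 \<noteq> k mod 3"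
  by presburger+

lemma Suc_mod_cong:
  assumes "k mod m = l mod m"
  shows "Suc k mod m = Suc l mod m"
  using assms by (metis mod_Suc_eq)

locale sparse_layers =
  fixes M :: "'a set set" and i :: nat
  assumes layer: "X \<in> M \<Longrightarrow> card X mod 3 = i"
    and daisy_free: "finite C \<Longrightarrow> finite D \<Longrightarrow> C \<inter> D = {} \<Longrightarrow> card D = 5 \<Longrightarrow>
      \<exists>x\<in>D. \<exists>y\<in>D. x \<noteq> y \<and> insert x (insert y C) \<notin> M"
begin

lemma off_layer: "B \<in> M \<Longrightarrow> card X mod 3 \<noteq> card B mod 3 \<Longrightarrow> X \<notin> M"
  using layer by blast

text \<open>Alternately deleting and adding keeps the path in the two layers just below \<open>B\<close>.\<close>

lemma zigzag:
  assumes "finite B" "finite C" "B \<in> M" "card B = Suc (card C)"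
  shows "geodesic M B C"
  using assms(2-)
proof (induction "card (C - B)" arbitrary: C)
  case 0
  then have sub: "C \<subseteq> B" by auto
  with 0 have "card (B - C) = 1" by (simp add: card_Diff_subset)
  then obtain x where "B - C = {x}" by (auto simp: card_1_singleton_iff)
  with sub have "x \<in> B - C" "insert x C = B" by auto
  then show ?case by (metis geodesic.add geodesic.stop)
next
  case (Suc k)
  then obtain y where y: "y \<in> C - B" by (metis card.empty all_not_in_conv nat.distinct(1))
  have "\<not> B \<subseteq> C"
    using Suc.prems card_mono[of C B] by auto
  then obtain x where x: "x \<in> B - C" by auto
  let ?D = "C - {y}" and ?E = "insert x (C - {y})"
  have "card C > 0" using y Suc.prems(1) by (auto simp: card_gt_0_iff)
  have cD: "Suc (card ?D) = card C" and cE: "card ?E = card C"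
    using x y Suc.prems(1) \<open>card C > 0\<close> by (auto simp: card_Diff_singleton)
  have D: "?D \<notin> M"
    by (rule off_layer[OF Suc.prems(2)]) (metis cD Suc.prems(3) Suc_mod_3_neq(2))
  have E: "?E \<notin> M"
    by (rule off_layer[OF Suc.prems(2)]) (metis cE Suc.prems(3) Suc_mod_3_neq(1))
  have "?E - B = (C - B) - {y}" using x by auto
  then have "k = card (?E - B)" using y Suc.hyps(2) Suc.prems(1) by simp
  then have "geodesic M B ?E" using Suc.hyps(1)[of ?E] Suc.prems cE by auto
  then have "geodesic M B ?D" by (rule geodesic.add[rotated 2]) (use x E in auto)
  then show ?case by (rule geodesic.del[rotated 2]) (use y D in auto)
qed

text \<open>A layer that meets \<open>M\<close> is crossed by adding a suitable pair from five elements of \<open>B - C\<close>; five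
  are available because \<open>C\<close> is two layers below the layer to cross, which is three layers or more
  below \<open>B\<close>.\<close>

lemma climb:
  assumes "finite B" "finite C" "B \<in> M" "card C mod 3 = Suc (card B) mod 3" "card C < card B"
  shows "geodesic M B C"
  using assms(2-)
proof (induction "card B - card C" arbitrary: C rule: less_induct)
  case less
  have pick: "\<exists>x. x \<in> B - X" if "card X < card B" "finite X" for X
    using card_mono[of X B] that by (metis DiffI linorder_not_le subsetI)
  \<comment> \<open>The congruence makes the gap 2 modulo 3. For gap 2, one addition reaches the
    layer just below \<open>B\<close>, where \<open>zigzag\<close> takes over.\<close>
  have "card B = card C + 2 \<or> card C + 5 \<le> card B"
    using less.prems(3,4) by presburger
  then consider "card B = card C + 2" | "card C + 5 \<le> card B" by blast
  then show ?case
  proof cases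
    case 1
    obtain x where x: "x \<in> B - C" using pick[of C] less.prems by auto
    have c: "card (insert x C) = Suc (card C)" using x less.prems by simp
    have "geodesic M B (insert x C)" by (rule zigzag) (use less.prems assms(1) c 1 in auto)
    moreover have "insert x C \<notin> M" by (rule off_layer[OF less.prems(2)]) (use c 1 Suc_mod_3_neq(1)[of "card (insert x C)"] in simp)
    ultimately show ?thesis using x by (auto intro: geodesic.add)
  next
    case 2
    have "5 \<le> card (B - C)" using 2 diff_card_le_card_Diff[OF less.prems(1), of B] by linarith
    then obtain D where D: "D \<subseteq> B - C" "card D = 5" "finite D"
      using assms(1) by (metis obtain_subset_with_card_n)
    then obtain x y where xy: "x \<in> D" "y \<in> D" "x \<noteq> y" "insert x (insert y C) \<notin> M"
      using daisy_free[of C D] less.prems by blast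
    let ?X = "insert x (insert y C)"
    have y: "card (insert y C) = Suc (card C)" and cX: "card ?X = card C + 2"
      using xy D less.prems(1) by (auto simp: card_insert_if)
    \<comment> \<open>Adding \<open>z\<close> steps past the crossed layer and restores the
      congruence, so the induction hypothesis applies three layers higher.\<close>
    obtain z where z: "z \<in> B - ?X"
      using pick[of ?X] cX 2 less.prems by auto
    have cZ: "card (insert z ?X) = card C + 3" using z cX less.prems(1) by (simp add: card_insert_if)
    have "geodesic M B (insert z ?X)"
      by (rule less.hyps) (use cZ 2 less.prems in auto)
    moreover have "insert z ?X \<notin> M"
      by (rule off_layer[OF less.prems(2)]) (use cZ less.prems(3) Suc_mod_3_neq(1) in simp)
    ultimately have "geodesic M B ?X" using z by (auto intro: geodesic.add)
    then have "geodesic M B (insert y C)"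
      by (rule geodesic.add[rotated 2]) (use xy D in auto)
    moreover have "insert y C \<notin> M"
      by (rule off_layer[OF less.prems(2)])
        (metis y Suc_mod_cong[OF less.prems(3)] Suc_mod_3_neq(2))
    ultimately show ?thesis using xy D by (auto intro: geodesic.add)
  qed
qed

text \<open>One step leaves the layer of \<open>A\<close>: downwards if the sizes agree, so that
  \<open>zigzag\<close> applies, and upwards if \<open>B\<close> is larger, so that
  \<open>climb\<close> applies.\<close>

lemma geodesic_up:
  assumes "finite A" "finite B" "A \<in> M" "B \<in> M" "card A \<le> card B"
  shows "geodesic M B A"
proof -
  have mods: "card A mod 3 = card B mod 3" using layer assms(3,4) by simp
  consider "A = B" | "A \<noteq> B" "card A = card B" | "card A < card B" using assms by linarith
  then show ?thesis
  proof cases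
    case 1
    then show ?thesis by (simp add: geodesic.stop)
  next
    case 2
    then have "\<not> A \<subseteq> B" using card_subset_eq[OF assms(2)] by auto
    then obtain y where y: "y \<in> A - B" by auto
    then have c: "card A = Suc (card (A - {y}))" using assms(1)
      by (metis DiffD1 card.remove)
    then have "geodesic M B (A - {y})"
      using 2 assms by (intro zigzag) auto
    moreover have "A - {y} \<notin> M" 
      by (rule off_layer[OF \<open>A \<in> M\<close>]) (metis c Suc_mod_3_neq(1))
    ultimately show ?thesis using y by (auto intro: geodesic.del)
  next
    case 3
    then have "\<not> B \<subseteq> A" using card_mono[OF assms(1)] leD by blast
    then obtain x where x: "x \<in> B - A" by auto
    then have c: "card (insert x A) = Suc (card A)" using assms(1) by simp
    have "Suc (card A) \<noteq> card B" using mods Suc_mod_3_neq(1) by metis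
    then have "card (insert x A) mod 3 = Suc (card B) mod 3" "card (insert x A) < card B"
      using 3 Suc_mod_cong[OF mods] by (simp_all add: c)
    then have "geodesic M B (insert x A)"
      using assms by (intro climb) auto
    moreover have "insert x A \<notin> M" 
      by (rule off_layer[OF \<open>A \<in> M\<close>]) (metis c Suc_mod_3_neq(1))
    ultimately show ?thesis using x by (auto intro: geodesic.add)
  qed
qed

end

lemma mutual_visibility_set_if_sparse_layers:
  assumes "sparse_layers M i" "M \<subseteq> Pow {1..n}"
  shows "mutual_visibility_set (with_proj (hypercube n)) M"
proof -
  have "visible (with_proj (hypercube n)) M A B" if "A \<in> M" "B \<in> M" "card A \<le> card B" for A B
  proof -
    have "A \<subseteq> {1..n}" "B \<subseteq> {1..n}" using that assms(2) by auto
    moreover from this have "finite A" "finite B" using finite_subset by blast+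
    ultimately show ?thesis
      using sparse_layers.geodesic_up[OF assms(1) _ _ that] by (intro visible_if_geodesic)
  qed
  then have "visible (with_proj (hypercube n)) M A B" if "A \<in> M" "B \<in> M" for A B
    using that visible_commute[OF symmetric_hypercube] nat_le_linear[of "card A" "card B"] by blast
  then show ?thesis
    using assms(2) by (simp add: mutual_visibility_set_def)
qed

section \<open>Linear independence over the field with three elements\<close>

text \<open>Nonzero elements are their own inverses, which replaces division in
  \<open>lin_indep_insert\<close>.\<close>

lemma square_eq_1_of_3:
  fixes a :: 3
  assumes "a \<noteq> 0"
  shows "a * a = 1"
  using assms
proof (induct a)
  case (of_int z)
  then have "z = 0 \<or> z = 1 \<or> z = 2" by fastforce
  then show ?case using of_int by auto
qed

text \<open>Extensional functions make equality and counting depend on the \<open>r\<close>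
  coordinates only; \<open>lincomb\<close> is restricted for the same reason.\<close>

definition vectors :: "nat \<Rightarrow> (nat \<Rightarrow> 3) set" where
  "vectors r = {..<r} \<rightarrow>\<^sub>E UNIV"

definition lincomb :: "nat \<Rightarrow> ('a \<Rightarrow> nat \<Rightarrow> 3) \<Rightarrow> 'a set \<Rightarrow> ('a \<Rightarrow> 3) \<Rightarrow> nat \<Rightarrow> 3" where
  "lincomb r v S c = (\<lambda>i\<in>{..<r}. \<Sum>x\<in>S. c x * v x i)"

text \<open>Independence of the indexed family rather than of its image: for finite
  \<open>S\<close>, two elements with the same vector are dependent.\<close>

definition lin_indep :: "nat \<Rightarrow> ('a \<Rightarrow> nat \<Rightarrow> 3) \<Rightarrow> 'a set \<Rightarrow> bool" where
  "lin_indep r v S \<longleftrightarrow> (\<forall>c. (\<forall>i<r. (\<Sum>x\<in>S. c x * v x i) = 0) \<longrightarrow> (\<forall>x\<in>S. c x = 0))"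

lemma finite_vectors [simp]: "finite (vectors r)"
  by (simp add: vectors_def finite_PiE)

lemma card_vectors: "card (vectors r) = 3 ^ r"
  by (simp add: vectors_def card_PiE)

lemma lincomb_in_vectors: "lincomb r v S c \<in> vectors r"
  by (simp add: lincomb_def vectors_def)

lemma lincomb_cong: "(\<And>x. x \<in> S \<Longrightarrow> c x = d x) \<Longrightarrow> lincomb r v S c = lincomb r v S d"
  by (simp add: lincomb_def)

lemma lincomb_eq_iff:
  "lincomb r v S c = lincomb r v S d \<longleftrightarrow> (\<forall>i<r. (\<Sum>x\<in>S. (c x - d x) * v x i) = 0)"
  by (auto simp: lincomb_def fun_eq_iff sum_subtractf left_diff_distrib)

lemma lincomb_inject:
  assumes "lin_indep r v S" "lincomb r v S c = lincomb r v S d" "x \<in> S"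
  shows "c x = d x"
proof -
  have "\<forall>x\<in>S. c x - d x = 0"
    using assms(1,2) unfolding lincomb_eq_iff lin_indep_def by (elim allE[of _ "\<lambda>x. c x - d x"]) simp
  with assms(3) show ?thesis by simp
qed

lemma lincomb_mono:
  assumes "finite T" "S \<subseteq> T" "\<And>x. x \<in> T - S \<Longrightarrow> c x = 0"
  shows "lincomb r v S c = lincomb r v T c"
  unfolding lincomb_def
  by (intro restrict_ext sum.mono_neutral_left) (use assms in auto)

lemma card_lincomb_le:
  assumes "finite S"
  shows "card (range (lincomb r v S)) \<le> 3 ^ card S"
proof -
  have "lincomb r v S c \<in> lincomb r v S ` (S \<rightarrow>\<^sub>E UNIV)" for c
    by (rule image_eqI[of _ _ "restrict c S"]) (auto intro: lincomb_cong)
  then have "range (lincomb r v S) \<subseteq> lincomb r v S ` (S \<rightarrow>\<^sub>E UNIV)" by blast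
  then have "card (range (lincomb r v S)) \<le> card (S \<rightarrow>\<^sub>E (UNIV :: 3 set))"
    using assms by (intro surj_card_le) (simp_all add: finite_PiE)
  also have "\<dots> = 3 ^ card S" using assms by (simp add: card_PiE)
  finally show ?thesis .
qed

text \<open>In a relation with nonzero coefficient at \<open>x\<close>, multiplying by that
  coefficient would put \<open>w\<close> in the span of the vectors of \<open>S\<close>.\<close>

lemma lin_indep_insert:
  assumes "finite S" "x \<notin> S" "lin_indep r v S" "w \<in> vectors r - range (lincomb r v S)"
  shows "lin_indep r (v(x := w)) (insert x S)"
  unfolding lin_indep_def
proof (intro allI impI)
  fix c :: "_ \<Rightarrow> 3"
  assume "\<forall>i<r. (\<Sum>y\<in>insert x S. c y * (v(x := w)) y i) = 0"
  moreover have "(\<Sum>y\<in>S. c y * (v(x := w)) y i) = (\<Sum>y\<in>S. c y * v y i)" for i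
    by (rule sum.cong) (use assms(2) in auto)
  ultimately have eq: "c x * w i + (\<Sum>y\<in>S. c y * v y i) = 0" if "i < r" for i
    using that assms(1,2) by simp
  have cx: "c x = 0"
  proof (rule ccontr)
    assume "c x \<noteq> 0"
    then have sq: "c x * c x = 1" by (rule square_eq_1_of_3)
    have "w i = (\<Sum>y\<in>S. (- c x * c y) * v y i)" if "i < r" for i
    proof -
      have "c x * (c x * w i + (\<Sum>y\<in>S. c y * v y i)) = 0" using eq[OF that] by simp
      then have "w i = - (c x * (\<Sum>y\<in>S. c y * v y i))"
        by (simp add: distrib_left mult.assoc[symmetric] sq eq_neg_iff_add_eq_0)
      then show ?thesis by (simp add: sum_distrib_left mult.assoc sum_negf)
    qed
    moreover have "w \<in> vectors r" using assms(4) by simp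
    ultimately have "w = lincomb r v S (\<lambda>y. - c x * c y)"
      by (auto simp: lincomb_def vectors_def fun_eq_iff PiE_def extensional_def)
    with assms(4) show False by blast
  qed
  with eq have "\<forall>i<r. (\<Sum>y\<in>S. c y * v y i) = 0" by simp
  with assms(3) cx show "\<forall>y\<in>insert x S. c y = 0" by (simp add: lin_indep_def)
qed

lemma lin_indep_subset:
  assumes "lin_indep r v T" "finite T" "S \<subseteq> T"
  shows "lin_indep r v S"
  unfolding lin_indep_def
proof (intro allI impI)
  fix c :: "_ \<Rightarrow> 3"
  assume c: "\<forall>i<r. (\<Sum>x\<in>S. c x * v x i) = 0"
  let ?d = "\<lambda>x. if x \<in> S then c x else 0"
  have "(\<Sum>x\<in>T. ?d x * v x i) = (\<Sum>x\<in>S. c x * v x i)" for i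
    by (rule sum.mono_neutral_cong_right) (use assms in auto)
  with c have "\<forall>i<r. (\<Sum>x\<in>T. ?d x * v x i) = 0" by simp
  with assms(1) have "\<forall>x\<in>T. ?d x = 0" unfolding lin_indep_def by (elim allE[of _ ?d] impE)
  with assms(3) show "\<forall>x\<in>S. c x = 0" by force
qed

text \<open>Choose the vectors on \<open>S\<close> one at a time: \<open>i\<close> vectors span at
  most \<open>3 ^ i\<close> elements, so at least \<open>3 ^ r - 3 ^ i\<close> choices remain for
  the next. Elements outside \<open>S\<close> are free. If \<open>card S > r\<close>, the factor for
  \<open>i = r\<close> is 0.\<close>

lemma card_lin_indep_ge:
  assumes "finite A" "S \<subseteq> A"
  shows "3 ^ (r * (card A - card S)) * (\<Prod>i<card S. 3 ^ r - 3 ^ i)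
    \<le> card {v \<in> A \<rightarrow>\<^sub>E vectors r. lin_indep r v S}"
proof -
  have "finite S" using assms finite_subset by blast
  then show ?thesis using assms
  proof (induction S arbitrary: A)
    case empty
    have "{v \<in> A \<rightarrow>\<^sub>E vectors r. lin_indep r v {}} = A \<rightarrow>\<^sub>E vectors r"
      by (simp add: lin_indep_def)
    moreover have "card (A \<rightarrow>\<^sub>E vectors r) = 3 ^ (r * card A)"
      using empty by (simp add: card_PiE card_vectors power_mult)
    ultimately show ?case by simp
  next
    case (insert x S)
    define A' where "A' = A - {x}"
    have A': "A = insert x A'" "x \<notin> A'" "S \<subseteq> A'" "finite A'"
      using insert unfolding A'_def by auto
    then have cA: "card A = Suc (card A')" by simp
    let ?I = "{v \<in> A' \<rightarrow>\<^sub>E vectors r. lin_indep r v S}"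
    let ?P = "SIGMA v:?I. vectors r - range (lincomb r v S)"
    have fin: "finite (A' \<rightarrow>\<^sub>E vectors r)" "finite (A \<rightarrow>\<^sub>E vectors r)" using A' by (auto intro: finite_PiE)
    have "3 ^ r - 3 ^ card S \<le> card (vectors r - range (lincomb r v S))" for v
      using card_lincomb_le[OF insert.hyps(1), of r v]
        diff_card_le_card_Diff[of "range (lincomb r v S)" "vectors r"]
        finite_subset[of "range (lincomb r v S)" "vectors r"] lincomb_in_vectors[of r v S]
      by (simp add: card_vectors image_subset_iff)
    then have "card ?I * (3 ^ r - 3 ^ card S) \<le> (\<Sum>v\<in>?I. card (vectors r - range (lincomb r v S)))"
      using sum_bounded_below[of ?I "3 ^ r - 3 ^ card S"
          "\<lambda>v. card (vectors r - range (lincomb r v S))"] by simp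
    also have "\<dots> = card ?P" using fin by (simp add: card_SigmaI)
    also have "\<dots> = card ((\<lambda>(v, w). v(x := w)) ` ?P)"
    proof (rule card_image[symmetric], rule inj_onI, clarify)
      fix v w v' w'
      assume vs: "v \<in> A' \<rightarrow>\<^sub>E vectors r" "v' \<in> A' \<rightarrow>\<^sub>E vectors r" and eq: "v(x := w) = v'(x := w')"
      \<comment> \<open>At \<open>y = x\<close> both sides are \<open>undefined\<close>, since
        \<open>x\<close> is not in \<open>A'\<close>.\<close>
      have "v y = v' y" for y
        using fun_cong[OF eq, of y] PiE_arb[OF vs(1) A'(2)] PiE_arb[OF vs(2) A'(2)] by (cases "y = x") auto
      moreover have "w = w'" using fun_cong[OF eq, of x] by simp
      ultimately show "v = v' \<and> w = w'" by auto
    qed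
    also have "\<dots> \<le> card {v \<in> A \<rightarrow>\<^sub>E vectors r. lin_indep r v (insert x S)}"
      by (rule card_mono) (use fin A' insert.hyps in \<open>auto intro: lin_indep_insert simp: PiE_insert_eq\<close>)
    finally have "card ?I * (3 ^ r - 3 ^ card S)
      \<le> card {v \<in> A \<rightarrow>\<^sub>E vectors r. lin_indep r v (insert x S)}" .
    moreover have "3 ^ (r * (card A' - card S)) * (\<Prod>i<card S. 3 ^ r - 3 ^ i) \<le> card ?I"
      using insert.IH A' by blast
    ultimately have "3 ^ (r * (card A' - card S)) * (\<Prod>i<card S. 3 ^ r - 3 ^ i) * (3 ^ r - 3 ^ card S)
      \<le> card {v \<in> A \<rightarrow>\<^sub>E vectors r. lin_indep r v (insert x S)}"
      using mult_le_mono1 le_trans by blast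
    then show ?case
      using insert.hyps cA by (simp add: mult.assoc)
  qed
qed

text \<open>Otherwise the span of \<open>C\<close> and its five complements in the spans of \<open>insert x C\<close>, \<open>x \<in> D\<close>, would
  be pairwise disjoint and contain \<open>(1 + 5 * 2) * 3 ^ card C > 3 ^ r\<close> vectors.\<close>

lemma lin_indep_daisy_free:
  assumes "finite C" "finite D" "C \<inter> D = {}" "card D = 5" "r = card C + 2"
  shows "\<exists>x\<in>D. \<exists>y\<in>D. x \<noteq> y \<and> \<not> lin_indep r v (insert x (insert y C))"
proof (rule ccontr)
  assume "\<not> ?thesis"
  then have ind: "lin_indep r v (insert x (insert y C))" if "x \<in> D" "y \<in> D" "x \<noteq> y" for x y
    using that by blast
  \<comment> \<open>Given independence, \<open>?U x\<close> is the span of \<open>insert x C\<close>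
    without the span of \<open>C\<close>: two choices at \<open>x\<close> and three at each element
    of \<open>C\<close>.\<close>
  let ?K = "\<lambda>x. {c \<in> insert x C \<rightarrow>\<^sub>E (UNIV :: 3 set). c x \<noteq> 0}"
  let ?U = "\<lambda>x. lincomb r v (insert x C) ` ?K x"
  let ?Z = "lincomb r v C ` (C \<rightarrow>\<^sub>E (UNIV :: 3 set))"
  have ind1: "lin_indep r v (insert x C)" if "x \<in> D" for x
  proof -
    have "\<not> D \<subseteq> {x}" using assms(4) card_mono[of "{x}" D] by auto
    then obtain y where "y \<in> D" "y \<noteq> x" by blast
    then show ?thesis
      using lin_indep_subset[OF ind[OF that, of y]] assms(1) by auto
  qed
  have "card ?Z = 3 ^ card C"
  proof -
    have "D \<noteq> {}" using assms(4) by auto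
    then have "lin_indep r v C" using lin_indep_subset[OF ind1] assms(1) by blast
    then have "inj_on (lincomb r v C) (C \<rightarrow>\<^sub>E (UNIV :: 3 set))"
      by (intro inj_onI) (metis PiE_ext lincomb_inject)
    then show ?thesis using assms(1) by (simp add: card_image card_PiE)
  qed
  have cU: "card (?U x) = 2 * 3 ^ card C" if "x \<in> D" for x
  proof -
    have x: "x \<notin> C" using that assms(3) by blast
    have "inj_on (lincomb r v (insert x C)) (?K x)"
      by (intro inj_onI) (metis (no_types, lifting) PiE_ext lincomb_inject[OF ind1[OF that]] mem_Collect_eq)
    then have "card (?U x) = card (?K x)" by (rule card_image)
    moreover have "?K x = (\<Pi>\<^sub>E y\<in>insert x C. if y = x then - {0 :: 3} else UNIV)"
      using x by (auto simp: PiE_def Pi_def split: if_splits)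
    moreover have "card (\<Pi>\<^sub>E y\<in>insert x C. if y = x then - {0 :: 3} else UNIV) = 2 * (3 :: nat) ^ card C"
    proof -
      have "card (\<Pi>\<^sub>E y\<in>insert x C. if y = x then - {0 :: 3} else UNIV) =
        (\<Prod>y\<in>insert x C. card (if y = x then - {0 :: 3} else UNIV))"
        using assms(1) by (simp add: card_PiE)
      also have "\<dots> = card (- {0 :: 3}) * (\<Prod>y\<in>C. card (if y = x then - {0 :: 3} else UNIV))"
        using assms(1) x by simp
      also have "(\<Prod>y\<in>C. card (if y = x then - {0 :: 3} else UNIV)) = (\<Prod>y\<in>C. 3)"
        by (rule prod.cong) (use x in auto)
      also have "card (- {0 :: 3}) = 2" by (simp add: Compl_eq_Diff_UNIV card_Diff_singleton)
      finally show ?thesis by simp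
    qed
    ultimately show ?thesis by simp
  qed
  have disj: "?U x \<inter> ?U y = {}" if "x \<in> D" "y \<in> D" "x \<noteq> y" for x y
  proof -
    have xy: "x \<notin> C" "y \<notin> C" using that assms(3) by auto
    have False if c: "c \<in> ?K x" and d: "d \<in> ?K y"
      and eq: "lincomb r v (insert x C) c = lincomb r v (insert y C) d" for c d
    proof -
      \<comment> \<open>Pad both combinations with zeros to the independent family on
        \<open>?T\<close> and compare coefficients at \<open>x\<close>. The updates are needed
        because \<open>c\<close> and \<open>d\<close> are \<open>undefined\<close>, not 0, outside
        their domains.\<close>
      let ?T = "insert x (insert y C)"
      have "lincomb r v (insert x C) (c(y := 0)) = lincomb r v ?T (c(y := 0))"
        "lincomb r v (insert y C) (d(x := 0)) = lincomb r v ?T (d(x := 0))"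
        using assms(1) xy \<open>x \<noteq> y\<close> by (intro lincomb_mono; auto)+
      moreover have "lincomb r v (insert x C) (c(y := 0)) = lincomb r v (insert x C) c"
        "lincomb r v (insert y C) (d(x := 0)) = lincomb r v (insert y C) d"
        using xy \<open>x \<noteq> y\<close> by (intro lincomb_cong; auto)+
      ultimately have "lincomb r v ?T (c(y := 0)) = lincomb r v ?T (d(x := 0))"
        using eq by metis
      then have "(c(y := 0)) x = (d(x := 0)) x"
        by (rule lincomb_inject[OF ind[OF \<open>x \<in> D\<close> \<open>y \<in> D\<close> \<open>x \<noteq> y\<close>]]) simp
      then show False using c \<open>x \<noteq> y\<close> by simp
    qed
    then show ?thesis by blast
  qed
  have disj0: "?Z \<inter> (\<Union>x\<in>D. ?U x) = {}"
  proof -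
    have False if "x \<in> D" and c: "c \<in> ?K x" and eq: "lincomb r v C d = lincomb r v (insert x C) c" for x c d
    proof -
      have x: "x \<notin> C" using that assms(3) by auto
      have "lincomb r v C (d(x := 0)) = lincomb r v (insert x C) (d(x := 0))"
        using assms(1) x by (intro lincomb_mono) auto
      moreover have "lincomb r v C (d(x := 0)) = lincomb r v C d"
        using x by (intro lincomb_cong) auto
      ultimately have "lincomb r v (insert x C) (d(x := 0)) = lincomb r v (insert x C) c"
        using eq by metis
      then have "(d(x := 0)) x = c x"
        by (rule lincomb_inject[OF ind1[OF \<open>x \<in> D\<close>]]) simp
      then show False using c by simp
    qed
    then show ?thesis by blast
  qed
  have finU: "finite (?U x)" for x
    by (rule finite_subset[OF _ finite_vectors[of r]]) (use lincomb_in_vectors in blast)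
  then have fin: "finite ?Z" "finite (\<Union>x\<in>D. ?U x)"
    using assms(1,2) by (simp_all add: finite_PiE)
  have "card (\<Union>x\<in>D. ?U x) = (\<Sum>x\<in>D. card (?U x))"
    using assms(2) finU disj by (intro card_UN_disjoint ballI impI)
  also have "\<dots> = 10 * 3 ^ card C" using cU assms(4) by simp
  finally have "card (?Z \<union> (\<Union>x\<in>D. ?U x)) = 11 * 3 ^ card C"
    using card_Un_disjoint[OF fin disj0] \<open>card ?Z = 3 ^ card C\<close> by simp
  moreover have "card (?Z \<union> (\<Union>x\<in>D. ?U x)) \<le> card (vectors r)"
    by (rule card_mono) (use lincomb_in_vectors in \<open>simp, blast\<close>)
  ultimately show False by (simp add: card_vectors assms(5))
qed

section \<open>Large daisy-free layers\<close>

text \<open>The bound is the product of the first three factors times \<open>1 - (1 / 3 ^ 4 + 1 / 3 ^ 5 + \<dots>) = 53 / 54\<close>.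
  Its excess over \<open>14 / 25\<close> makes the final inequality strict.\<close>

lemma prod_one_minus_inverse_power_3_ge:
  "11024 / 19683 \<le> (\<Prod>k<r. 1 - 1 / 3 ^ Suc k :: real)"
proof -
  \<comment> \<open>Here \<open>416 / 729\<close> is the product of the first three factors. Since
    \<open>1 / (2 * 3 ^ r)\<close> is the tail of the geometric series after
    \<open>1 / 3 ^ r\<close>, the bracket equals 1 minus the sum of \<open>1 / 3 ^ k\<close> for
    \<open>k\<close> from 4 to \<open>r\<close>.\<close>
  have large: "416 / 729 * (53 / 54 + 1 / (2 * 3 ^ r)) \<le> (\<Prod>k<r. 1 - 1 / 3 ^ Suc k :: real)"
    if "r \<ge> 3" for r
    using that
  proof (induction r rule: dec_induct)
    case base
    show ?case by (simp add: eval_nat_numeral)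
  next
    case (step r)
    define u :: real where "u = 1 / 3 ^ Suc r"
    have "(3 :: real) ^ 4 \<le> 3 ^ Suc r" using step.hyps by (intro power_increasing) auto
    then have u: "0 < u" "u \<le> 1 / 81" by (auto simp: u_def field_simps)
    \<comment> \<open>In terms of \<open>u\<close>, the term \<open>1 / (2 * 3 ^ r)\<close> is
      \<open>3 / 2 * u\<close>, and \<open>u \<le> 1 / 81\<close> is exactly what makes the second
      factor nonnegative.\<close>
    have "0 \<le> u * (1 / 54 - 3 / 2 * u)" using u by simp
    also have "\<dots> = (53 / 54 + 3 / 2 * u) * (1 - u) - (53 / 54 + u / 2)"
      by (simp add: field_simps)
    finally have "53 / 54 + u / 2 \<le> (53 / 54 + 3 / 2 * u) * (1 - u)" by simp
    then have "416 / 729 * (53 / 54 + u / 2) \<le> (416 / 729 * (53 / 54 + 3 / 2 * u)) * (1 - u)"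
      unfolding mult.assoc by (rule mult_left_mono) simp
    also have "416 / 729 * (53 / 54 + 3 / 2 * u) = 416 / 729 * (53 / 54 + 1 / (2 * 3 ^ r))"
      by (simp add: u_def)
    also have "\<dots> * (1 - u) \<le> (\<Prod>k<r. 1 - 1 / 3 ^ Suc k) * (1 - u)"
      by (rule mult_right_mono) (use step.IH u in auto)
    finally show ?case by (simp add: u_def)
  qed
  consider "r = 0" | "r = 1" | "r = 2" | "r \<ge> 3" by linarith
  then show ?thesis
  proof cases
    case 4
    have "11024 / 19683 \<le> 416 / 729 * (53 / 54 + 1 / (2 * 3 ^ r :: real))" by simp
    with large[OF 4] show ?thesis by linarith
  qed (simp_all add: eval_nat_numeral)
qed

text \<open>Take \<open>3 ^ r\<close> out of every factor and reverse the order of the product.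
  Divided by \<open>3 ^ (r * r)\<close>, this is the probability that \<open>r\<close> random
  vectors form a basis.\<close>

lemma prod_power_diff_3:
  "real (\<Prod>i<r. 3 ^ r - 3 ^ i) = 3 ^ (r * r) * (\<Prod>k<r. 1 - 1 / 3 ^ Suc k)"
proof -
  have "real (3 ^ r - 3 ^ i) = 3 ^ r * (1 - 1 / 3 ^ Suc (r - Suc i))" if "i < r" for i
  proof -
    have "3 ^ r = (3 ^ i * 3 ^ (r - i) :: real)" "Suc (r - Suc i) = r - i"
      using that by (simp_all flip: power_add)
    moreover have "(3 :: nat) ^ i \<le> 3 ^ r" using that by simp
    ultimately show ?thesis by (simp add: of_nat_diff field_simps)
  qed
  then have "real (\<Prod>i<r. 3 ^ r - 3 ^ i) = (\<Prod>i<r. 3 ^ r * (1 - 1 / 3 ^ Suc (r - Suc i)))"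
    unfolding of_nat_prod by (intro prod.cong) auto
  also have "\<dots> = 3 ^ (r * r) * (\<Prod>i<r. 1 - 1 / 3 ^ Suc (r - Suc i))"
    by (simp add: prod.distrib power_mult)
  also have "(\<Prod>i<r. 1 - 1 / 3 ^ Suc (r - Suc i)) = (\<Prod>k<r. 1 - 1 / 3 ^ Suc k :: real)"
    by (rule prod.nat_diff_reindex)
  finally show ?thesis .
qed

text \<open>Averaging: every \<open>r\<close>-set is independent under at least the fraction
  \<open>11024 / 19683\<close> of all assignments. Counting pairs of a set and an assignment in both
  orders shows that not every assignment can fall short.\<close>

lemma ex_many_lin_indep:
  assumes "finite A"
  shows "\<exists>v. 11024 / 19683 * real (card A choose r) \<le>
    real (card {S. S \<subseteq> A \<and> card S = r \<and> lin_indep r v S})"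
proof (rule ccontr)
  assume "\<not> ?thesis"
  then have less: "real (card {S. S \<subseteq> A \<and> card S = r \<and> lin_indep r v S}) <
      11024 / 19683 * real (card A choose r)" for v
    by (simp add: not_le)
  let ?V = "A \<rightarrow>\<^sub>E vectors r" and ?F = "{S. S \<subseteq> A \<and> card S = r}"
  have fin: "finite ?V" "finite ?F"
    using assms by (auto intro: finite_PiE)
  have cV: "card ?V = 3 ^ (r * card A)"
    using assms by (simp add: card_PiE card_vectors power_mult)
  have "11024 / 19683 * 3 ^ (r * card A) \<le> real (card {v \<in> ?V. lin_indep r v S})" if "S \<in> ?F" for S
  proof -
    have S: "S \<subseteq> A" "card S = r" using that by auto
    have le: "r \<le> card A" using S card_mono[OF assms] by blast
    have "r * card A = r * (card A - r) + r * r"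
      using le by (simp flip: distrib_left)
    then have "11024 / 19683 * 3 ^ (r * card A) = 3 ^ (r * (card A - r)) * (3 ^ (r * r) * (11024 / 19683 :: real))"
      by (simp add: power_add)
    also have "\<dots> \<le> 3 ^ (r * (card A - r)) * (3 ^ (r * r) * (\<Prod>k<r. 1 - 1 / 3 ^ Suc k))"
      by (intro mult_left_mono prod_one_minus_inverse_power_3_ge) auto
    also have "\<dots> = real (3 ^ (r * (card A - r)) * (\<Prod>i<r. 3 ^ r - 3 ^ i))"
      by (simp only: prod_power_diff_3 of_nat_mult of_nat_power of_nat_numeral)
    also have "\<dots> \<le> real (card {v \<in> ?V. lin_indep r v S})"
      using card_lin_indep_ge[OF assms S(1), of r] S(2) by (simp only: of_nat_le_iff)
    finally show ?thesis .
  qed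
  then have "real (card ?F) * (11024 / 19683 * 3 ^ (r * card A)) \<le>
      (\<Sum>S\<in>?F. real (card {v \<in> ?V. lin_indep r v S}))"
    by (rule sum_bounded_below)
  also have "\<dots> = real (\<Sum>S\<in>?F. \<Sum>v\<in>{v \<in> ?V. lin_indep r v S}. 1)" by simp
  also have "(\<Sum>S\<in>?F. \<Sum>v\<in>{v \<in> ?V. lin_indep r v S}. 1) = (\<Sum>v\<in>?V. \<Sum>S\<in>{S \<in> ?F. lin_indep r v S}. 1 :: nat)"
    by (rule sum.swap_restrict[OF fin(2,1)])
  also have "real \<dots> = (\<Sum>v\<in>?V. real (card {S. S \<subseteq> A \<and> card S = r \<and> lin_indep r v S}))"
    by (simp add: conj_assoc)
  also have "\<dots> < (\<Sum>v\<in>?V. 11024 / 19683 * real (card A choose r))"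
  proof (rule sum_strict_mono[OF fin(1)])
    show "?V \<noteq> {}" using cV by (metis card.empty power_not_zero zero_neq_numeral)
  qed (rule less)
  also have "\<dots> = real (card ?F) * (11024 / 19683 * 3 ^ (r * card A))"
    using n_subsets[OF assms, of r] cV by simp
  finally show False by simp
qed

text \<open>Pigeonhole: the three residue classes partition the full row sum
  \<open>2 ^ n\<close>.\<close>

lemma ex_residue_binomial_sum_ge:
  "\<exists>i<3. 2 ^ n \<le> 3 * (\<Sum>r | r \<le> n \<and> r mod 3 = i. n choose r)"
proof (rule ccontr)
  let ?s = "\<lambda>i. \<Sum>r | r \<le> n \<and> r mod 3 = i. n choose r"
  assume "\<not> ?thesis"
  then have less: "3 * ?s i < 2 ^ n" if "i < 3" for i using that by (simp add: not_le)
  have "(\<Sum>i<3. sum ((choose) n) {r \<in> {..n}. r mod 3 = i}) = (\<Sum>r\<le>n. n choose r)"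
    by (rule sum.group) auto
  then have "(\<Sum>i<3. ?s i) = 2 ^ n" by (simp only: atMost_iff choose_row_sum)
  moreover have "{..<3} = {0, 1, 2 :: nat}" by auto
  ultimately have "?s 0 + ?s 1 + ?s 2 = 2 ^ n" by (simp add: add.assoc)
  with less[of 0] less[of 1] less[of 2] show False by linarith
qed

theorem theorem1p2:
  fixes n :: nat
  assumes "n \<ge> 1"
  shows "real (mutual_visibility_number (with_proj (hypercube n))) > 14 / 75 * 2 ^ n"
proof -
  obtain i where i: "2 ^ n \<le> 3 * (\<Sum>r | r \<le> n \<and> r mod 3 = i. n choose r)"
    using ex_residue_binomial_sum_ge by blast
  let ?R = "{r. r \<le> n \<and> r mod 3 = i}"
  let ?F = "\<lambda>v r. {S. S \<subseteq> {1..n} \<and> card S = r \<and> lin_indep r (v r) S}"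
  have "\<forall>r. \<exists>v. 11024 / 19683 * real (n choose r) \<le>
    real (card {S. S \<subseteq> {1..n} \<and> card S = r \<and> lin_indep r v S})"
    using ex_many_lin_indep[of "{1..n}"] by simp
  \<comment> \<open>The assignments for different \<open>r\<close> need not be related, because all
    sets of a daisy lie in one layer.\<close>
  from choice[OF this] obtain v
    where v: "\<forall>r. 11024 / 19683 * real (n choose r) \<le> real (card (?F v r))" ..
  define M where "M = (\<Union>r\<in>?R. ?F v r)"
  have "sparse_layers M i"
  proof
    show "card X mod 3 = i" if "X \<in> M" for X using that by (auto simp: M_def)
    fix C D :: "nat set"
    assume CD: "finite C" "finite D" "C \<inter> D = {}" "card D = 5"
    let ?r = "card C + 2"
    obtain x y where xy: "x \<in> D" "y \<in> D" "x \<noteq> y" "\<not> lin_indep ?r (v ?r) (insert x (insert y C))"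
      using lin_indep_daisy_free[OF CD refl] by blast
    then have "card (insert x (insert y C)) = ?r"
      using CD(1,3) by (auto simp: card_insert_if)
    with xy(4) have "insert x (insert y C) \<notin> M" by (auto simp: M_def)
    with xy show "\<exists>x\<in>D. \<exists>y\<in>D. x \<noteq> y \<and> insert x (insert y C) \<notin> M" by blast
  qed
  moreover have "M \<subseteq> Pow {1..n}" by (auto simp: M_def)
  ultimately have M: "mutual_visibility_set (with_proj (hypercube n)) M"
    by (rule mutual_visibility_set_if_sparse_layers)
  have "14 / 75 * 2 ^ n < 11024 / 19683 * (2 ^ n / 3 :: real)" by simp
  also have "\<dots> \<le> 11024 / 19683 * (\<Sum>r\<in>?R. real (n choose r))"
  proof -
    have "real (2 ^ n) \<le> real (3 * (\<Sum>r\<in>?R. n choose r))" using i by (simp only: of_nat_le_iff)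
    then show ?thesis by simp
  qed
  also have "\<dots> \<le> (\<Sum>r\<in>?R. real (card (?F v r)))"
    unfolding sum_distrib_left by (rule sum_mono) (rule v[rule_format])
  also have "\<dots> = real (card M)"
    unfolding M_def of_nat_sum[symmetric] by (subst card_UN_disjoint) auto
  also have "\<dots> \<le> real (mutual_visibility_number (with_proj (hypercube n)))"
    using mutual_visibility_number_witness(2)[OF _ M] by simp
  finally show ?thesis .
qed

end
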